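(* Let $\mathcal{X}$ be an infinite-dimensional real Banach space and let $\mathcal{A}\subset\mathcal{B}(\mathcal{X})$ be an $L$-algebra. (i) If $\mathcal{A}$ is of complex type, then $\mathrm{rank}(T)$ is even for any $T\in\mathcal{A}^F$. (ii) If $\mathcal{A}$ is of quaternion type, then $\mathrm{rank}(T)$ is divisible by four for any $T\in\mathcal{A}^F$.
   Context: $\mathcal{B}(\mathcal{X})$ denotes the algebra of all bounded linear operators on $\mathcal{X}$. An algebra of operators on $\mathcal{X}$ is a (real) subalgebra of $\mathcal{B}(\mathcal{X})$, not assumed unital or closed. It is transitive if it has no non-trivial closed invariant subspaces. An $L$-algebra is a transitive algebra of operators on $\mathcal{X}$ that contains a non-zero finite rank operator. For an $L$-algebra $\mathcal{A}$, $\mathcal{A}^F$ is the set of all finite rank operators in $\mathcal{A}$, and $\mathcal{X}^F=\mathrm{lin}\{Tx: T\in\mathcal{A}^F, x\in\mathcal{X}\}$ (a dense $\mathcal{A}$-invariant linear subspace). $\mathbb{D}$ is the algebra of all linear operators $\mathcal{X}^F\to\mathcal{X}^F$ (not assumed bounded) commuting with the restrictions to $\mathcal{X}^F$ of all operators in $\mathcal{A}^F$; it is always a finite-dimensional real division algebra, hence isomorphic to $\mathbb{R}$, $\mathbb{C}$ or the quaternions $\mathbb{H}$. $\mathcal{A}$ is of real, complex or quaternion type if $\mathbb{D}$ is isomorphic to $\mathbb{R}$, $\mathbb{C}$ or $\mathbb{H}$, respectively. The rank of an operator is the (real) dimension of its range. *)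

theory Defs
  imports "HOL-Analysis.Analysis"
begin

datatype quaternion = Quaternion (Q0: real) (Q1: real) (Q2: real) (Q3: real)

lemma quaternion_eq_iff:
  "p = q \<longleftrightarrow> Q0 p = Q0 q \<and> Q1 p = Q1 q \<and> Q2 p = Q2 q \<and> Q3 p = Q3 q"
  by (cases p; cases q) simp

instantiation quaternion :: real_algebra_1
begin

definition "0 = Quaternion 0 0 0 0"
definition "1 = Quaternion 1 0 0 0"
definition "p + q = Quaternion (Q0 p + Q0 q) (Q1 p + Q1 q) (Q2 p + Q2 q) (Q3 p + Q3 q)"
definition "p - q = Quaternion (Q0 p - Q0 q) (Q1 p - Q1 q) (Q2 p - Q2 q) (Q3 p - Q3 q)"
definition "- q = Quaternion (- Q0 q) (- Q1 q) (- Q2 q) (- Q3 q)"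
definition "r *\<^sub>R q = Quaternion (r * Q0 q) (r * Q1 q) (r * Q2 q) (r * Q3 q)"
definition "p * q = Quaternion
  (Q0 p * Q0 q - Q1 p * Q1 q - Q2 p * Q2 q - Q3 p * Q3 q)
  (Q0 p * Q1 q + Q1 p * Q0 q + Q2 p * Q3 q - Q3 p * Q2 q)
  (Q0 p * Q2 q - Q1 p * Q3 q + Q2 p * Q0 q + Q3 p * Q1 q)
  (Q0 p * Q3 q + Q1 p * Q2 q - Q2 p * Q1 q + Q3 p * Q0 q)"

lemmas quaternion_defs =
  zero_quaternion_def one_quaternion_def plus_quaternion_def minus_quaternion_def
  uminus_quaternion_def scaleR_quaternion_def times_quaternion_def

instance
  by standard (simp_all add: quaternion_defs quaternion_eq_iff algebra_simps)

end

lemma quaternion_units: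
  fixes i j k :: quaternion
  defines "i \<equiv> Quaternion 0 1 0 0" and "j \<equiv> Quaternion 0 0 1 0" and "k \<equiv> Quaternion 0 0 0 1"
  shows "i * i = - 1" "j * j = - 1" "k * k = - 1"
    "i * j = k" "j * k = i" "k * i = j" "j * i = - k" "k * j = - i" "i * k = - j"
  by (simp_all add: i_def j_def k_def quaternion_defs)

definition finite_dim :: "'a::real_vector set \<Rightarrow> bool" where
  "finite_dim V \<longleftrightarrow> (\<exists>B. finite B \<and> span B = V)"

definition finite_rank :: "('a::real_normed_vector \<Rightarrow>\<^sub>L 'a) \<Rightarrow> bool" where
  "finite_rank T \<longleftrightarrow> finite_dim (range (blinfun_apply T))"

text \<open>Only meaningful for operators of finite rank: \<^const>\<open>dim\<close> is a natural number,
  and is 0 on infinite-dimensional spaces.\<close>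

definition rank_op :: "('a::real_normed_vector \<Rightarrow>\<^sub>L 'a) \<Rightarrow> nat" where
  "rank_op T = dim (range (blinfun_apply T))"

definition operator_algebra :: "('a::real_normed_vector \<Rightarrow>\<^sub>L 'a) set \<Rightarrow> bool" where
  "operator_algebra A \<longleftrightarrow> subspace A \<and> (\<forall>S\<in>A. \<forall>T\<in>A. S o\<^sub>L T \<in> A)"

definition transitive_algebra :: "('a::real_normed_vector \<Rightarrow>\<^sub>L 'a) set \<Rightarrow> bool" where
  "transitive_algebra A \<longleftrightarrow> operator_algebra A \<and>
     (\<forall>Y. subspace Y \<and> closed Y \<and> (\<forall>T\<in>A. blinfun_apply T ` Y \<subseteq> Y) \<longrightarrow> Y = {0} \<or> Y = UNIV)"

definition L_algebra :: "('a::real_normed_vector \<Rightarrow>\<^sub>L 'a) set \<Rightarrow> bool" where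
  "L_algebra A \<longleftrightarrow> transitive_algebra A \<and> (\<exists>T\<in>A. T \<noteq> 0 \<and> finite_rank T)"

definition fin_rank_part :: "('a::real_normed_vector \<Rightarrow>\<^sub>L 'a) set \<Rightarrow> ('a \<Rightarrow>\<^sub>L 'a) set" where
  "fin_rank_part A = {T \<in> A. finite_rank T}"

definition XF :: "('a::real_normed_vector \<Rightarrow>\<^sub>L 'a) set \<Rightarrow> 'a set" where
  "XF A = span {blinfun_apply T x | T x. T \<in> fin_rank_part A}"

text \<open>A linear operator on the subspace \<^term>\<open>XF A\<close> is encoded as a function on the whole
  space that vanishes outside \<^term>\<open>XF A\<close>. Each operator then has exactly one representative,
  and the algebra operations are pointwise addition, pointwise scaling and composition.\<close>

definition commutant_XF :: "('a::real_normed_vector \<Rightarrow>\<^sub>L 'a) set \<Rightarrow> ('a \<Rightarrow> 'a) set" where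
  "commutant_XF A = {f.
     (\<forall>x\<in>XF A. f x \<in> XF A) \<and> (\<forall>x. x \<notin> XF A \<longrightarrow> f x = 0) \<and>
     (\<forall>x\<in>XF A. \<forall>y\<in>XF A. f (x + y) = f x + f y) \<and>
     (\<forall>r. \<forall>x\<in>XF A. f (r *\<^sub>R x) = r *\<^sub>R f x) \<and>
     (\<forall>T\<in>fin_rank_part A. \<forall>x\<in>XF A. f (blinfun_apply T x) = blinfun_apply T (f x))}"

definition real_algebra_iso ::
    "('b::real_algebra_1 \<Rightarrow> 'a \<Rightarrow> 'a) \<Rightarrow> ('a::real_vector \<Rightarrow> 'a) set \<Rightarrow> bool" where
  "real_algebra_iso \<phi> D \<longleftrightarrow> bij_betw \<phi> UNIV D \<and>
     (\<forall>p q v. \<phi> (p + q) v = \<phi> p v + \<phi> q v) \<and>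
     (\<forall>r p v. \<phi> (r *\<^sub>R p) v = r *\<^sub>R \<phi> p v) \<and>
     (\<forall>p q. \<phi> (p * q) = \<phi> p \<circ> \<phi> q)"

definition complex_type :: "('a::real_normed_vector \<Rightarrow>\<^sub>L 'a) set \<Rightarrow> bool" where
  "complex_type A \<longleftrightarrow> (\<exists>\<phi> :: complex \<Rightarrow> 'a \<Rightarrow> 'a. real_algebra_iso \<phi> (commutant_XF A))"

definition quaternion_type :: "('a::real_normed_vector \<Rightarrow>\<^sub>L 'a) set \<Rightarrow> bool" where
  "quaternion_type A \<longleftrightarrow> (\<exists>\<phi> :: quaternion \<Rightarrow> 'a \<Rightarrow> 'a. real_algebra_iso \<phi> (commutant_XF A))"

end

theory Submission
  imports Defs
begin

text \<open>
  The rank of \<open>T\<close> is divisible by the real dimension of the commutant \<open>\<bbbD>\<close>, because the range of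
  \<open>T\<close> is a vector space over the division algebra \<open>\<bbbD>\<close>.

  A priori the elements of \<open>\<bbbD>\<close> are defined on \<open>\<X>\<^sup>F\<close> only and need not be bounded, so they need
  not extend to the closure \<open>\<X>\<close> of \<open>\<X>\<^sup>F\<close>. This does no harm: \<open>T \<X>\<^sup>F\<close> is dense in \<open>T \<X>\<close>, and being
  finite-dimensional it is closed, whence \<open>T \<X> = T \<X>\<^sup>F\<close> (lemma \<open>range_finite_rank_eq_image_dense\<close>).
  An element \<open>f\<close> of \<open>\<bbbD>\<close> maps this space into itself, since \<open>f (T x) = T (f x)\<close>.

  It remains to count dimensions. A finite-dimensional module over a division algebra of real
  dimension \<open>d\<close> is free, and so its real dimension is a multiple of \<open>d\<close>
  (lemma \<open>card_basis_dvd_dim_division_module\<close>). The two parts of the theorem are the cases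
  \<open>d = 2\<close> of the complex numbers and \<open>d = 4\<close> of the quaternions.
\<close>

section \<open>Finite-dimensional subspaces of normed spaces\<close>

text \<open>If a point \<open>x\<close> has distance at least \<open>d > 0\<close> from the closed subspace \<open>span S\<close>, then the coefficient
  of \<open>x\<close> in an element of \<open>span (insert x S)\<close> has modulus at most \<open>1 / d\<close> times the norm of that element.
  In a convergent sequence of such elements the coefficients are therefore Cauchy.\<close>

lemma closed_span_insert:
  fixes x :: "'a::real_normed_vector"
  assumes cl: "closed (span S)"
  shows "closed (span (insert x S))"
proof (cases "x \<in> span S")
  case True
  then show ?thesis using cl by (simp add: span_redundant)
next
  case False
  then obtain d where d: "d > 0" "ball x d \<subseteq> - span S"
    using cl open_contains_ball[of "- span S"] by blast
  then have dist: "d \<le> dist x y" if "y \<in> span S" for y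
    using that by (meson ComplD in_mono mem_ball not_le)
  have coeff_bound: "\<bar>t\<bar> * d \<le> norm (v + t *\<^sub>R x)" if v: "v \<in> span S" for v t
  proof (cases "t = 0")
    case False
    have "- (inverse t *\<^sub>R v) \<in> span S"
      using v by (intro span_neg span_scale)
    then have "d \<le> norm (x + inverse t *\<^sub>R v)"
      using dist by (force simp: dist_norm)
    then have "\<bar>t\<bar> * d \<le> \<bar>t\<bar> * norm (x + inverse t *\<^sub>R v)"
      by (rule mult_left_mono) simp
    also have "\<dots> = norm (t *\<^sub>R (x + inverse t *\<^sub>R v))"
      by simp
    also have "t *\<^sub>R (x + inverse t *\<^sub>R v) = v + t *\<^sub>R x"
      using False by (simp add: algebra_simps)
    finally show ?thesis .
  qed simp
  show ?thesis
    unfolding closed_sequential_limits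
  proof (intro allI impI)
    fix z l
    assume "(\<forall>n. z n \<in> span (insert x S)) \<and> z \<longlonglongrightarrow> l"
    then have zin: "\<And>n. \<exists>k. z n - k *\<^sub>R x \<in> span S" and lim: "z \<longlonglongrightarrow> l"
      by (auto simp: span_breakdown_eq)
    from zin obtain t where t: "\<And>n. z n - t n *\<^sub>R x \<in> span S"
      by metis
    have diff: "\<bar>t m - t n\<bar> * d \<le> dist (z m) (z n)" for m n
    proof -
      have "(z m - t m *\<^sub>R x) - (z n - t n *\<^sub>R x) \<in> span S"
        by (intro span_diff[OF t t])
      from coeff_bound[OF this, of "t m - t n"] show ?thesis
        by (simp add: dist_norm algebra_simps)
    qed
    have "Cauchy t"
      unfolding Cauchy_def
    proof (intro allI impI)
      fix e :: real
      assume "e > 0"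
      then have "e * d > 0" using d(1) by simp
      then obtain M where M: "\<forall>m\<ge>M. \<forall>n\<ge>M. dist (z m) (z n) < e * d"
        using LIMSEQ_imp_Cauchy[OF lim] unfolding Cauchy_def by blast
      have "dist (t m) (t n) < e" if "m \<ge> M" "n \<ge> M" for m n
      proof -
        have "\<bar>t m - t n\<bar> * d < e * d"
          using diff[of m n] M that by (meson le_less_trans)
        then show ?thesis using d(1) by (simp add: dist_real_def)
      qed
      then show "\<exists>M. \<forall>m\<ge>M. \<forall>n\<ge>M. dist (t m) (t n) < e" by blast
    qed
    then obtain c where "t \<longlonglongrightarrow> c"
      using Cauchy_convergent convergent_def by blast
    then have "(\<lambda>n. z n - t n *\<^sub>R x) \<longlonglongrightarrow> l - c *\<^sub>R x"
      using lim by (intro tendsto_intros)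
    then have "l - c *\<^sub>R x \<in> span S"
      by (rule closed_sequentially[OF cl t])
    then show "l \<in> span (insert x S)"
      by (auto simp: span_breakdown_eq)
  qed
qed

lemma closed_span_finite:
  fixes S :: "'a::real_normed_vector set"
  assumes "finite S"
  shows "closed (span S)"
  using assms by (induction S) (simp_all add: closed_span_insert)

lemma subspace_of_finite_dim_is_span:
  assumes "subspace U" "finite B" "U \<subseteq> span B"
  obtains C where "finite C" "independent C" "span C = U"
proof -
  obtain C where C: "C \<subseteq> U" "independent C" "U \<subseteq> span C"
    using maximal_independent_subset by blast
  have "finite C"
    using independent_span_bound[OF assms(2) C(2)] C(1) assms(3) by blast
  moreover have "span C = U"
    using C assms(1) by (simp add: span_subspace)
  ultimately show thesis using C(2) that by blast
qed

lemma range_finite_rank_eq_image_dense: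
  fixes T :: "'a::real_normed_vector \<Rightarrow>\<^sub>L 'a"
  assumes "finite_rank T" and U: "subspace U" "closure U = UNIV"
  shows "range (blinfun_apply T) = blinfun_apply T ` U"
proof
  obtain B where B: "finite B" "span B = range (blinfun_apply T)"
    using assms(1) unfolding finite_rank_def finite_dim_def by blast
  have "subspace (blinfun_apply T ` U)"
    by (rule real_vector.linear_subspace_image)
      (use U(1) blinfun.bounded_linear_right bounded_linear.linear in blast)+
  then obtain C where "finite C" "span C = blinfun_apply T ` U"
    using subspace_of_finite_dim_is_span[OF _ B(1)] B(2) by (metis image_mono subset_UNIV)
  then have "closed (blinfun_apply T ` U)"
    using closed_span_finite by metis
  then have "blinfun_apply T ` closure U \<subseteq> blinfun_apply T ` U"
    by (intro image_closure_subset)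
      (auto intro: linear_continuous_on blinfun.bounded_linear_right)
  then show "range (blinfun_apply T) \<subseteq> blinfun_apply T ` U"
    using U(2) by simp
qed auto

lemma subspace_closure_of_subspace:
  fixes U :: "'a::real_normed_vector set"
  assumes "subspace U"
  shows "subspace (closure U)"
proof (rule subspaceI)
  show "0 \<in> closure U"
    using assms closure_subset subspace_0 by blast
next
  fix x y
  assume "x \<in> closure U" "y \<in> closure U"
  then obtain f g where "\<forall>n. f n \<in> U" "f \<longlonglongrightarrow> x" "\<forall>n. g n \<in> U" "g \<longlonglongrightarrow> y"
    unfolding closure_sequential by blast
  then have "(\<forall>n. f n + g n \<in> U) \<and> (\<lambda>n. f n + g n) \<longlonglongrightarrow> x + y"
    using assms by (auto intro: subspace_add tendsto_add)
  then show "x + y \<in> closure U"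
    unfolding closure_sequential by (rule exI[where x = "\<lambda>n. f n + g n"])
next
  fix c x
  assume "x \<in> closure U"
  then obtain f where "\<forall>n. f n \<in> U" "f \<longlonglongrightarrow> x"
    unfolding closure_sequential by blast
  then have "(\<forall>n. c *\<^sub>R f n \<in> U) \<and> (\<lambda>n. c *\<^sub>R f n) \<longlonglongrightarrow> c *\<^sub>R x"
    using assms by (auto intro: subspace_scale tendsto_scaleR)
  then show "c *\<^sub>R x \<in> closure U"
    unfolding closure_sequential by (rule exI[where x = "\<lambda>n. c *\<^sub>R f n"])
qed

section \<open>Modules over division algebras\<close>

lemma independent_Un_trivial_Int:
  fixes A B :: "'a::real_vector set"
  assumes "finite B" "independent A" "independent B" "span A \<inter> span B \<subseteq> {0}"
  shows "independent (A \<union> B)"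
  using assms(1,3,4)
proof (induction B)
  case empty
  then show ?case using assms(2) by simp
next
  case (insert b B)
  have b: "independent B" "b \<notin> span B"
    using insert.prems(1) insert.hyps(2) by (simp_all add: independent_insert)
  have sub: "span B \<subseteq> span (insert b B)"
    by (rule span_mono) blast
  have "b \<notin> span (A \<union> B)"
  proof
    assume "b \<in> span (A \<union> B)"
    then obtain a c where ac: "b = a + c" "a \<in> span A" "c \<in> span B"
      unfolding span_Un by blast
    have "b - c \<in> span (insert b B)"
      using ac(3) sub by (intro span_diff) (auto intro: span_base)
    then have "a = 0"
      using ac insert.prems(2) by auto
    then show False using ac b(2) by simp
  qed
  moreover have "independent (A \<union> B)"
    using insert.IH b(1) insert.prems(2) sub by blast
  ultimately show ?case by (simp add: independent_insertI)
qed

text \<open>As for vector spaces over a field, the module is exhausted by free cyclic submodules. If a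
  submodule spanned by \<open>S\<close> misses \<open>v\<close>, then it meets \<open>\<bbbD> v\<close> trivially: from \<open>p v \<in> span S\<close> with
  \<open>p \<noteq> 0\<close> one recovers \<open>v\<close> by applying an inverse of \<open>p\<close>. Hence the multiples of \<open>v\<close> by the \<open>d\<close>
  elements of a real basis of \<open>\<bbbD>\<close> can be added to \<open>S\<close>. So a real-independent set \<open>S\<close> of greatest
  cardinality, among those that span a submodule and have a multiple of \<open>d\<close> elements, spans the
  whole module.\<close>

lemma card_basis_dvd_dim_division_module:
  fixes \<phi> :: "'b::real_algebra_1 \<Rightarrow> 'a::real_vector \<Rightarrow> 'a" and V :: "'a set"
  assumes V: "subspace V" "finite F" "V \<subseteq> span F"
    and D: "finite D" "independent D" "span D = (UNIV :: 'b set)"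
    and inverse: "\<And>p::'b. p \<noteq> 0 \<Longrightarrow> \<exists>q. q * p = 1"
    and closed: "\<And>p v. v \<in> V \<Longrightarrow> \<phi> p v \<in> V"
    and lin: "\<And>v. linear (\<lambda>p. \<phi> p v)"
    and add: "\<And>p v w. v \<in> V \<Longrightarrow> w \<in> V \<Longrightarrow> \<phi> p (v + w) = \<phi> p v + \<phi> p w"
    and mult: "\<And>p q v. v \<in> V \<Longrightarrow> \<phi> (p * q) v = \<phi> p (\<phi> q v)"
    and one: "\<And>v. v \<in> V \<Longrightarrow> \<phi> 1 v = v"
  shows "card D dvd dim V"
proof -
  define P where "P S \<longleftrightarrow> independent S \<and> S \<subseteq> V \<and> card D dvd card S \<and>
    (\<forall>p. \<forall>v\<in>span S. \<phi> p v \<in> span S)" for S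
  have fin: "finite S \<and> card S \<le> card F" if "P S" for S
    using independent_span_bound[OF V(2), of S] that V(3) unfolding P_def by blast
  have phi0: "\<phi> p 0 = 0" for p
    using add[of 0 0 p] subspace_0[OF V(1)] by simp
  have "P {}"
    unfolding P_def using phi0 by (simp add: independent_empty)
  then obtain S where S: "P S" and max: "\<And>S'. P S' \<Longrightarrow> card S' \<le> card S"
    using ex_has_greatest_nat[of P "{}" card "Suc (card F)"] fin less_Suc_eq_le by metis
  have ind: "independent S" and SV: "S \<subseteq> V" and dvd: "card D dvd card S"
    and inv: "\<And>p v. v \<in> span S \<Longrightarrow> \<phi> p v \<in> span S"
    using S unfolding P_def by auto
  have spanV: "span S \<subseteq> V"
    using SV V(1) by (simp add: span_minimal)
  have "V \<subseteq> span S"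
  proof
    fix v
    assume v: "v \<in> V"
    show "v \<in> span S"
    proof (rule ccontr)
      assume nv: "v \<notin> span S"
      define f where "f p = \<phi> p v" for p
      have linf: "linear f"
        using lin unfolding f_def .
      have fV: "f p \<in> V" for p
        unfolding f_def using closed v by blast
      have meet: "p = 0" if p: "f p \<in> span S" for p
      proof (rule ccontr)
        assume "p \<noteq> 0"
        then obtain q where "q * p = 1" using inverse by blast
        then have "\<phi> q (f p) = v"
          unfolding f_def using mult[OF v, of q p] one[OF v] by simp
        then show False using inv[OF p, of q] nv by simp
      qed
      have "inj f"
        using linear_injective_0[OF linf] meet span_zero by metis
      then have inj: "inj_on f X" for X
        by (rule inj_on_subset) simp
      have indf: "independent (f ` D)"
        by (rule linear_independent_injective_image[OF linf D(2) inj])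
      have cardf: "card (f ` D) = card D"
        by (rule card_image[OF inj])
      have spanf: "span (f ` D) = range f"
        using linear_span_image[OF linf, of D] D(3) by simp
      have int0: "span S \<inter> span (f ` D) \<subseteq> {0}"
        unfolding spanf using meet linear_0[OF linf] by auto
      have "S \<inter> f ` D = {}"
      proof -
        have "S \<inter> f ` D \<subseteq> {0}"
          using int0 span_superset[of S] span_superset[of "f ` D"] by blast
        moreover have "0 \<notin> S"
          using ind dependent_zero by blast
        ultimately show ?thesis
          by (metis IntD1 insertI1 subset_singletonD)
      qed
      then have card: "card (S \<union> f ` D) = card S + card D"
        using card_Un_disjoint[of S "f ` D"] fin[OF S] D(1) cardf by (metis finite_imageI)
      have "\<phi> p w \<in> span (S \<union> f ` D)" if w: "w \<in> span (S \<union> f ` D)" for p w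
      proof -
        obtain a q where a: "a \<in> span S" "w = a + f q"
          using w unfolding span_Un spanf by auto
        have "\<phi> p w = \<phi> p a + \<phi> p (f q)"
          using add a spanV fV by blast
        also have "\<phi> p (f q) = f (p * q)"
          unfolding f_def using mult v by simp
        finally show ?thesis
          unfolding span_Un spanf using inv[OF a(1)] by blast
      qed
      then have "P (S \<union> f ` D)"
        unfolding P_def
        using independent_Un_trivial_Int[OF _ ind indf int0] D(1) SV fV dvd card by auto
      then have "card D = 0"
        using max card by force
      then have "(UNIV :: 'b set) = {0}"
        using D(1,3) by auto
      then show False
        using zero_neq_one[where 'a = 'b] by (metis UNIV_I singletonD)
    qed
  qed
  then have "span S = V" using spanV by blast
  then have "dim V = card S"
    using ind dim_span_eq_card_independent by blast
  then show ?thesis using dvd by simp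
qed

section \<open>The commutant acts on ranges\<close>

lemma fin_rank_apply_in_XF:
  assumes "T \<in> fin_rank_part A"
  shows "blinfun_apply T x \<in> XF A"
  unfolding XF_def by (rule span_base) (use assms in blast)

text \<open>\<open>\<X>\<^sup>F\<close> is invariant because the finite rank operators form a left ideal of the algebra, so
  its closure is a non-zero closed invariant subspace.\<close>

lemma closure_XF:
  assumes "L_algebra A"
  shows "closure (XF A) = UNIV"
proof -
  let ?G = "{blinfun_apply T x | T x. T \<in> fin_rank_part A}"
  have tr: "Y = {0} \<or> Y = UNIV"
    if "subspace Y" "closed Y" "\<And>T. T \<in> A \<Longrightarrow> blinfun_apply T ` Y \<subseteq> Y" for Y
    using assms that unfolding L_algebra_def transitive_algebra_def by blast
  have comp: "S o\<^sub>L T \<in> A" if "S \<in> A" "T \<in> A" for S T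
    using assms that unfolding L_algebra_def transitive_algebra_def operator_algebra_def by blast
  have inv: "blinfun_apply S ` XF A \<subseteq> XF A" if S: "S \<in> A" for S
  proof -
    have linS: "linear (blinfun_apply S)"
      by (simp add: blinfun.bounded_linear_right bounded_linear.linear)
    have "blinfun_apply S ` ?G \<subseteq> ?G"
    proof clarify
      fix T x
      assume T: "T \<in> fin_rank_part A"
      then obtain B where B: "finite B" "span B = range (blinfun_apply T)"
        unfolding fin_rank_part_def finite_rank_def finite_dim_def by blast
      have "span (blinfun_apply S ` B) = range (blinfun_apply (S o\<^sub>L T))"
        using linear_span_image[OF linS, of B] B(2) by (simp add: image_image)
      then have "S o\<^sub>L T \<in> fin_rank_part A"
        using comp S T B(1) unfolding fin_rank_part_def finite_rank_def finite_dim_def by blast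
      moreover have "blinfun_apply S (blinfun_apply T x) = blinfun_apply (S o\<^sub>L T) x"
        by simp
      ultimately show "\<exists>T' x'. blinfun_apply S (blinfun_apply T x) = blinfun_apply T' x' \<and>
          T' \<in> fin_rank_part A"
        by blast
    qed
    then show ?thesis
      unfolding XF_def linear_span_image[OF linS, symmetric] by (rule span_mono)
  qed
  have "blinfun_apply S ` closure (XF A) \<subseteq> closure (XF A)" if "S \<in> A" for S
    by (intro image_closure_subset)
      (use inv[OF that] closure_subset in
        \<open>auto intro: linear_continuous_on blinfun.bounded_linear_right\<close>)
  moreover have "subspace (closure (XF A))"
    by (intro subspace_closure_of_subspace) (simp add: XF_def)
  ultimately have alt: "closure (XF A) = {0} \<or> closure (XF A) = UNIV"
    using tr by simp
  obtain T where T: "T \<in> fin_rank_part A" "T \<noteq> 0"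
    using assms unfolding L_algebra_def fin_rank_part_def by blast
  then obtain x where "blinfun_apply T x \<noteq> 0"
    by (metis blinfun_eqI zero_blinfun.rep_eq)
  moreover have "blinfun_apply T x \<in> closure (XF A)"
    using fin_rank_apply_in_XF[OF T(1)] closure_subset by (rule subsetD[rotated])
  ultimately show ?thesis using alt by blast
qed

text \<open>An algebra isomorphism onto the commutant sends \<open>1\<close> to its unit element, which is the
  identity of \<open>\<X>\<^sup>F\<close> continued by zero.\<close>

lemma iso_one_on_XF:
  assumes iso: "real_algebra_iso \<phi> (commutant_XF A)" and v: "v \<in> XF A"
  shows "\<phi> 1 v = v"
proof -
  have sub: "subspace (XF A)" unfolding XF_def by simp
  define e where "e x = (if x \<in> XF A then x else 0)" for x
  have "e \<in> commutant_XF A"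
    unfolding commutant_XF_def e_def using sub
    by (auto simp: subspace_add subspace_scale fin_rank_apply_in_XF)
  then obtain p where p: "\<phi> p = e"
    using iso unfolding real_algebra_iso_def bij_betw_def by (metis imageE)
  have "\<phi> 1 v \<in> XF A"
    using iso v unfolding real_algebra_iso_def bij_betw_def commutant_XF_def by blast
  then have "\<phi> 1 v = \<phi> p (\<phi> 1 v)"
    using p unfolding e_def by simp
  also have "\<dots> = \<phi> (p * 1) v"
    using iso unfolding real_algebra_iso_def by (metis comp_apply)
  also have "\<dots> = v"
    using p v unfolding e_def by simp
  finally show ?thesis .
qed

text \<open>Since \<open>T \<X> = T \<X>\<^sup>F\<close>, every vector of the range is \<open>T x\<close> with \<open>x\<close> in the domain of the
  commutant. Only for such \<open>x\<close> can an element of the commutant be moved past \<open>T\<close>, which is what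
  turns the range into a module.\<close>

theorem dimension_of_commutant_dvd_rank:
  fixes \<phi> :: "'b::real_algebra_1 \<Rightarrow> 'a::real_normed_vector \<Rightarrow> 'a"
  assumes L: "L_algebra A" and iso: "real_algebra_iso \<phi> (commutant_XF A)"
    and D: "finite D" "independent D" "span D = (UNIV :: 'b set)"
    and inverse: "\<And>p::'b. p \<noteq> 0 \<Longrightarrow> \<exists>q. q * p = 1"
    and T: "T \<in> fin_rank_part A"
  shows "card D dvd rank_op T"
proof -
  let ?V = "range (blinfun_apply T)"
  have fr: "finite_rank T"
    using T unfolding fin_rank_part_def by simp
  then obtain F where F: "finite F" "span F = ?V"
    unfolding finite_rank_def finite_dim_def by blast
  have subV: "subspace ?V"
    using F(2) by (metis subspace_span)
  have VXF: "?V \<subseteq> XF A"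
    using fin_rank_apply_in_XF[OF T] by blast
  have VT: "?V = blinfun_apply T ` XF A"
    by (rule range_finite_rank_eq_image_dense[OF fr _ closure_XF[OF L]]) (simp add: XF_def)
  have com: "\<phi> p \<in> commutant_XF A" for p
    using iso unfolding real_algebra_iso_def bij_betw_def by blast
  have phiT: "\<phi> p (blinfun_apply T x) = blinfun_apply T (\<phi> p x)" if "x \<in> XF A" for p x
    using com[of p] T that unfolding commutant_XF_def by blast
  have phi_add: "\<phi> p (v + w) = \<phi> p v + \<phi> p w" if "v \<in> XF A" "w \<in> XF A" for p v w
    using com[of p] that unfolding commutant_XF_def by blast
  have "card D dvd dim ?V"
  proof (rule card_basis_dvd_dim_division_module[OF subV F(1) _ D inverse, where \<phi> = \<phi>])
    show "\<phi> p v \<in> ?V" if "v \<in> ?V" for p v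
      using that phiT unfolding VT
      by (metis (no_types, lifting) VT imageE rangeI)
    show "linear (\<lambda>p. \<phi> p v)" for v
      using iso unfolding real_algebra_iso_def by (intro linearI) blast+
    show "\<phi> p (v + w) = \<phi> p v + \<phi> p w" if "v \<in> ?V" "w \<in> ?V" for p v w
      using that VXF phi_add by blast
    show "\<phi> (p * q) v = \<phi> p (\<phi> q v)" for p q v
      using iso unfolding real_algebra_iso_def by (metis comp_apply)
    show "\<phi> 1 v = v" if "v \<in> ?V" for v
      using that VXF iso_one_on_XF[OF iso] by blast
  qed (simp_all add: F(2))
  then show ?thesis unfolding rank_op_def .
qed

section \<open>Quaternions\<close>

text \<open>The left inverse is the conjugate divided by the squared norm.\<close>

lemma quaternion_left_inverse:
  fixes p :: quaternion
  assumes "p \<noteq> 0"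
  shows "\<exists>q. q * p = 1"
proof -
  define n where "n = (Q0 p)\<^sup>2 + (Q1 p)\<^sup>2 + (Q2 p)\<^sup>2 + (Q3 p)\<^sup>2"
  have "n \<noteq> 0"
    using assms unfolding n_def quaternion_eq_iff zero_quaternion_def
    by (auto simp: add_nonneg_eq_0_iff)
  then have "(inverse n *\<^sub>R Quaternion (Q0 p) (- Q1 p) (- Q2 p) (- Q3 p)) * p = 1"
    by (simp add: quaternion_defs quaternion_eq_iff field_simps)
      (simp add: n_def power2_eq_square)
  then show ?thesis by blast
qed

lemma quaternion_basis:
  obtains D :: "quaternion set" where "finite D" "independent D" "span D = UNIV" "card D = 4"
proof -
  define f :: "real \<times> real \<times> real \<times> real \<Rightarrow> quaternion"
    where "f = (\<lambda>(a, b, c, d). Quaternion a b c d)"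
  have lin: "linear f"
    by (rule linearI) (auto simp: f_def quaternion_defs)
  have inj: "inj f"
    by (auto simp: f_def inj_def)
  have surj: "surj f"
    unfolding surj_def f_def by (metis case_prod_conv quaternion.exhaust)
  show thesis
  proof
    show "finite (f ` Basis)"
      by simp
    show "independent (f ` Basis)"
      using lin inj
      by (intro linear_independent_injective_image independent_Basis) (auto intro: inj_on_subset)
    show "span (f ` Basis) = UNIV"
      using linear_span_image[OF lin, of Basis] surj by simp
    show "card (f ` Basis) = 4"
      using inj by (simp add: card_image inj_on_subset)
  qed
qed

theorem proposition2p14:
  fixes A :: "('a::banach \<Rightarrow>\<^sub>L 'a) set"
  assumes "\<not> finite_dim (UNIV :: 'a set)"
    and "L_algebra A"
  shows "(complex_type A \<longrightarrow> (\<forall>T\<in>fin_rank_part A. even (rank_op T))) \<and>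
         (quaternion_type A \<longrightarrow> (\<forall>T\<in>fin_rank_part A. 4 dvd rank_op T))"
proof (intro conjI impI ballI)
  fix T
  assume "complex_type A" and T: "T \<in> fin_rank_part A"
  then obtain \<phi> :: "complex \<Rightarrow> 'a \<Rightarrow> 'a" where iso: "real_algebra_iso \<phi> (commutant_XF A)"
    unfolding complex_type_def by blast
  have "\<exists>q. q * p = 1" if "p \<noteq> 0" for p :: complex
    using that left_inverse by blast
  then have "card (Basis :: complex set) dvd rank_op T"
    by (intro dimension_of_commutant_dvd_rank[OF assms(2) iso _ _ _ _ T])
      (simp_all add: independent_Basis)
  then show "even (rank_op T)" by simp
next
  fix T
  assume "quaternion_type A" and T: "T \<in> fin_rank_part A"
  then obtain \<phi> :: "quaternion \<Rightarrow> 'a \<Rightarrow> 'a" where iso: "real_algebra_iso \<phi> (commutant_XF A)"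
    unfolding quaternion_type_def by blast
  obtain D :: "quaternion set"
    where "finite D" "independent D" "span D = UNIV" "card D = 4"
    by (rule quaternion_basis)
  then show "4 dvd rank_op T"
    using dimension_of_commutant_dvd_rank[OF assms(2) iso _ _ _ quaternion_left_inverse T]
    by metis
qed

end
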